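(* Let $\mathcal{C}$ be the category of bounded-below chain complexes over $\mathbb{C}$ and let $S_{\bullet}\mathcal{C}$ be the category of simplicial objects in $\mathcal{C}$. There exist simplicial chain complexes $C_{*,\bullet}=\{[n]\mapsto C_{*,n}\}_{n\ge 0}$ and $D_{*,\bullet}=\{[n]\mapsto D_{*,n}\}_{n\ge 0}$ in $S_{\bullet}\mathcal{C}$ such that: (P1) there exists a morphism of graded chain complexes $\{\phi_n: C_{*,n}\to D_{*,n}\}_{n\ge 0}$ (that is, a chain map $\phi_n$ for each $n\geq 0$) with $\phi_n$ a quasi-isomorphism for each $n$; (P2) for each morphism $\alpha\in \mathrm{Hom}_{\Delta}([m],[n])$ there is a canonical chain homotopy $$\phi_m\circ C_{*,\bullet}(\alpha)\simeq D_{*,\bullet}(\alpha)\circ \phi_n : C_{*,n}\to D_{*,m};$$ (P3) $H_*(\mathrm{Tot}_*\, C_{*,\bullet})\neq H_*(\mathrm{Tot}_*\, D_{*,\bullet})$, i.e. these graded $\mathbb{C}$-vector spaces are not isomorphic.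
   Context: $\Delta$ is the simplex category. A simplicial object in $\mathcal{C}$ is a functor $\Delta^{op}\to\mathcal{C}$; for such a functor $C_{*,\bullet}$ and $\alpha:[m]\to[n]$ in $\Delta$, $C_{*,\bullet}(\alpha): C_{*,n}\to C_{*,m}$ denotes the induced chain map. $\mathrm{Tot}_*(C_{*,\bullet})$ is the total complex of the double complex whose columns are the chain complexes $C_{*,n}$ and whose second differential $C_{*,n}\to C_{*,n-1}$ is the alternating sum of the face maps. *)

theory Defs
  imports "Jordan_Normal_Form.VS_Connect" "HOL-Algebra.AbelCoset"
begin

hide_const (open) Modules.module_hom

text \<open>
  Complex vector spaces are the vector spaces with explicit carrier over the field
  \<open>class_ring :: complex ring\<close>, and linear maps are the
  elements of \<open>module_hom class_ring V W\<close>; maps are only constrained on the carriers.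
\<close>

definition vs_iso :: "(complex, 'a) module \<Rightarrow> (complex, 'b) module \<Rightarrow> ('a \<Rightarrow> 'b) \<Rightarrow> bool" where
  "vs_iso V W f \<longleftrightarrow> f \<in> module_hom class_ring V W \<and> bij_betw f (carrier V) (carrier W)"

text \<open>
  The quotient \<open>V / W\<close> by a subspace \<open>W\<close>; its elements are the cosets of \<open>W\<close>. The scalar
  multiple of the coset of \<open>x\<close> by \<open>c\<close> is the coset of \<open>c x\<close>: all members of the union below
  coincide. The record fields \<open>mult\<close> and \<open>one\<close> of a module carry no information.
\<close>

definition quotient_vs :: "(complex, 'a) module \<Rightarrow> 'a set \<Rightarrow> (complex, 'a set) module" where
  "quotient_vs V W =
    \<lparr>carrier = a_rcosets\<^bsub>V\<^esub> W, mult = (\<lambda>_ _. W), one = W, zero = W, add = set_add V,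
     smult = (\<lambda>c S. \<Union>x\<in>S. W +>\<^bsub>V\<^esub> (c \<odot>\<^bsub>V\<^esub> x))\<rparr>"


section \<open>Chain complexes\<close>

record 'a graded_cx =
  chains :: "int \<Rightarrow> (complex, 'a) module"
  bd :: "int \<Rightarrow> 'a \<Rightarrow> 'a"

locale chain_complex =
  fixes X :: "'a graded_cx"
  assumes vectorspace_chains: "vectorspace class_ring (chains X q)"
    and bd_hom: "bd X q \<in> module_hom class_ring (chains X q) (chains X (q - 1))"
    and bd_bd: "x \<in> carrier (chains X q) \<Longrightarrow> bd X (q - 1) (bd X q x) = \<zero>\<^bsub>chains X (q - 2)\<^esub>"

definition bounded_below :: "'a graded_cx \<Rightarrow> bool" where
  "bounded_below X \<longleftrightarrow> (\<exists>N. \<forall>q<N. carrier (chains X q) = {\<zero>\<^bsub>chains X q\<^esub>})"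

definition chain_map :: "'a graded_cx \<Rightarrow> 'b graded_cx \<Rightarrow> (int \<Rightarrow> 'a \<Rightarrow> 'b) \<Rightarrow> bool" where
  "chain_map X Y f \<longleftrightarrow>
    (\<forall>q. f q \<in> module_hom class_ring (chains X q) (chains Y q) \<and>
      (\<forall>x\<in>carrier (chains X q). bd Y q (f q x) = f (q - 1) (bd X q x)))"

definition chain_homotopy ::
    "'a graded_cx \<Rightarrow> 'b graded_cx \<Rightarrow> (int \<Rightarrow> 'a \<Rightarrow> 'b) \<Rightarrow> (int \<Rightarrow> 'a \<Rightarrow> 'b) \<Rightarrow> (int \<Rightarrow> 'a \<Rightarrow> 'b) \<Rightarrow> bool" where
  "chain_homotopy X Y f g h \<longleftrightarrow>
    (\<forall>q. h q \<in> module_hom class_ring (chains X q) (chains Y (q + 1)) \<and>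
      (\<forall>x\<in>carrier (chains X q).
        f q x \<ominus>\<^bsub>chains Y q\<^esub> g q x = bd Y (q + 1) (h q x) \<oplus>\<^bsub>chains Y q\<^esub> h (q - 1) (bd X q x)))"

definition cycles :: "'a graded_cx \<Rightarrow> int \<Rightarrow> 'a set" where
  "cycles X q = a_kernel (chains X q) (chains X (q - 1)) (bd X q)"

definition boundaries :: "'a graded_cx \<Rightarrow> int \<Rightarrow> 'a set" where
  "boundaries X q = bd X (q + 1) ` carrier (chains X (q + 1))"

definition homology :: "'a graded_cx \<Rightarrow> int \<Rightarrow> (complex, 'a set) module" where
  "homology X q = quotient_vs (chains X q\<lparr>carrier := cycles X q\<rparr>) (boundaries X q)"

text \<open>
  The induced map on homology sends the class of a cycle \<open>x\<close> to the class of \<open>f x\<close>; for a chain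
  map all members of the union coincide.
\<close>

definition homology_map ::
    "'a graded_cx \<Rightarrow> 'b graded_cx \<Rightarrow> (int \<Rightarrow> 'a \<Rightarrow> 'b) \<Rightarrow> int \<Rightarrow> 'a set \<Rightarrow> 'b set" where
  "homology_map X Y f q S = (\<Union>x\<in>S. boundaries Y q +>\<^bsub>chains Y q\<^esub> f q x)"

definition quasi_iso :: "'a graded_cx \<Rightarrow> 'b graded_cx \<Rightarrow> (int \<Rightarrow> 'a \<Rightarrow> 'b) \<Rightarrow> bool" where
  "quasi_iso X Y f \<longleftrightarrow>
    chain_map X Y f \<and> (\<forall>q. vs_iso (homology X q) (homology Y q) (homology_map X Y f q))"


section \<open>Simplicial chain complexes\<close>

text \<open>
  The object \<open>[n]\<close> of the simplex category is \<open>{..n}\<close>; its morphisms are monotone maps, made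
  extensional so that they are determined by their restriction to the source.
\<close>

definition simplex_hom :: "nat \<Rightarrow> nat \<Rightarrow> (nat \<Rightarrow> nat) set" where
  "simplex_hom m n = {\<alpha> \<in> {..m} \<rightarrow>\<^sub>E {..n}. mono_on {..m} \<alpha>}"

text \<open>The injection \<open>[n] \<rightarrow> [n + 1]\<close> that misses \<open>i\<close>.\<close>

definition coface :: "nat \<Rightarrow> nat \<Rightarrow> nat \<Rightarrow> nat" where
  "coface n i = (\<lambda>j\<in>{..n}. if j < i then j else Suc j)"

text \<open>
  In \<open>act X m n \<alpha>\<close> both source \<open>[m]\<close> and target \<open>[n]\<close> of \<open>\<alpha>\<close> are recorded, since a function
  does not determine its target.
\<close>

record 'a simplicial_obj =
  level :: "nat \<Rightarrow> 'a graded_cx"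
  act :: "nat \<Rightarrow> nat \<Rightarrow> (nat \<Rightarrow> nat) \<Rightarrow> int \<Rightarrow> 'a \<Rightarrow> 'a"

locale simplicial_chain_complex =
  fixes X :: "'a simplicial_obj"
  assumes chain_complex_level: "chain_complex (level X n)"
    and bounded_below_level: "bounded_below (level X n)"
    and chain_map_act: "\<alpha> \<in> simplex_hom m n \<Longrightarrow> chain_map (level X n) (level X m) (act X m n \<alpha>)"
    and act_id: "x \<in> carrier (chains (level X n) q) \<Longrightarrow> act X n n (\<lambda>j\<in>{..n}. j) q x = x"
    and act_compose: "\<alpha> \<in> simplex_hom l m \<Longrightarrow> \<beta> \<in> simplex_hom m n \<Longrightarrow>
      x \<in> carrier (chains (level X n) q) \<Longrightarrow>
      act X l n (compose {..l} \<beta> \<alpha>) q x = act X l m \<alpha> q (act X m n \<beta> q x)"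

text \<open>
  \<open>Tot\<^sub>k\<close> is the direct sum of the \<open>C\<^bsub>k-p,p\<^esub>\<close> over \<open>p \<ge> 0\<close>: an element is a finitely supported
  family \<open>u\<close> with \<open>u p \<in> C\<^bsub>k-p,p\<^esub>\<close>. The total differential is
  \<open>(-1)\<^sup>p d + \<Sum>\<^sub>i (-1)\<^sup>i d\<^sub>i\<close> on \<open>C\<^bsub>q,p\<^esub>\<close>; the first sign makes it square to zero, as the
  internal differential \<open>d\<close> commutes with the faces \<open>d\<^sub>i\<close>.
\<close>

definition Tot_chains :: "'a simplicial_obj \<Rightarrow> int \<Rightarrow> (complex, nat \<Rightarrow> 'a) module" where
  "Tot_chains X k =
    \<lparr>carrier = {u. (\<forall>p. u p \<in> carrier (chains (level X p) (k - int p))) \<and>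
        finite {p. u p \<noteq> \<zero>\<^bsub>chains (level X p) (k - int p)\<^esub>}},
     mult = (\<lambda>_ _ p. \<zero>\<^bsub>chains (level X p) (k - int p)\<^esub>),
     one = (\<lambda>p. \<zero>\<^bsub>chains (level X p) (k - int p)\<^esub>),
     zero = (\<lambda>p. \<zero>\<^bsub>chains (level X p) (k - int p)\<^esub>),
     add = (\<lambda>u v p. u p \<oplus>\<^bsub>chains (level X p) (k - int p)\<^esub> v p),
     smult = (\<lambda>c u p. c \<odot>\<^bsub>chains (level X p) (k - int p)\<^esub> u p)\<rparr>"

definition face_sum :: "'a simplicial_obj \<Rightarrow> int \<Rightarrow> nat \<Rightarrow> 'a \<Rightarrow> 'a" where
  "face_sum X q p x =
    (\<Oplus>\<^bsub>chains (level X p) q\<^esub>i\<in>{..Suc p}.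
       (-1) ^ i \<odot>\<^bsub>chains (level X p) q\<^esub> act X p (Suc p) (coface p i) q x)"

definition Tot_bd :: "'a simplicial_obj \<Rightarrow> int \<Rightarrow> (nat \<Rightarrow> 'a) \<Rightarrow> nat \<Rightarrow> 'a" where
  "Tot_bd X k u p =
    ((-1) ^ p \<odot>\<^bsub>chains (level X p) (k - 1 - int p)\<^esub> bd (level X p) (k - int p) (u p))
      \<oplus>\<^bsub>chains (level X p) (k - 1 - int p)\<^esub> face_sum X (k - 1 - int p) p (u (Suc p))"

definition Tot :: "'a simplicial_obj \<Rightarrow> (nat \<Rightarrow> 'a) graded_cx" where
  "Tot X = \<lparr>chains = Tot_chains X, bd = Tot_bd X\<rparr>"

end

theory Submission
  imports Defs "HOL-Library.Nat_Bijection"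
begin

text \<open>
  Both examples have the same levels. Level \<open>n\<close> is the complex \<open>U\<^sub>n \<rightarrow> A\<^sub>n\<close> in degrees 1 and 0,
  where \<open>U\<^sub>n\<close> is the space of complex functions on \<open>[n]\<close>, \<open>A\<^sub>n\<close> the space of functions on
  \<open>[n] \<times> [n]\<close>, and the differential is the coboundary \<open>(\<delta> f) (i, j) = f j - f i\<close>. Its kernel
  consists of the constants, so that \<open>f \<circ> \<alpha>\<close> may be changed by a constant depending linearly on
  \<open>f\<close> without leaving the chain maps. For a complex number \<open>t\<close> let \<open>\<alpha>\<close> act in degree 1 by
  \<open>f \<mapsto> f \<circ> \<alpha> + t (f 0 - f (\<alpha> 0))\<close> and in degree 0 by pullback. This is functorial for every
  \<open>t\<close>; it is called \<open>twisted t\<close> below, and the theorem holds with \<open>C = twisted 0\<close> and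
  \<open>D = twisted 1\<close>.

  The number \<open>t\<close> is invisible up to homotopy. The correction \<open>f 0 - f (\<alpha> 0)\<close> is minus the value
  of \<open>\<delta> f\<close> at \<open>(0, \<alpha> 0)\<close>, hence factors through the differential. The actions
  for two values of \<open>t\<close> are therefore homotopic, by a homotopy given by an explicit formula in
  \<open>\<alpha>\<close> (\<open>chain_homotopy_twist\<close>), and each \<open>\<phi>\<^sub>n\<close> can be the identity.

  The total complex sees \<open>t\<close>. Split \<open>f = c + g\<close> with \<open>c\<close> constant and \<open>g 0 = 0\<close>. The action
  sends \<open>c + g\<close> to a function with value \<open>c + (1 - t) g (\<alpha> 0)\<close> at \<open>0\<close>. At \<open>t = 1\<close> the constants
  split off, and \<open>twisted 1\<close> is the direct sum of the constant simplicial object \<open>\<complex>\<close> in degree 1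
  and of \<open>U / \<complex> \<rightarrow> A\<close>; the summand \<open>\<complex>\<close> survives to the total homology in degree 1. At
  \<open>t = 0\<close> both \<open>U\<close> and \<open>A\<close> are contractible as simplicial vector spaces, by extension of
  functions by zero to a new vertex \<open>0\<close>, and the class disappears. In the spectral sequence of
  the double complex, the second differential is an isomorphism in one case and zero in the other.

  In degree 1 of \<open>Tot\<close> only the simplicial levels \<open>p \<le> 2\<close> matter, so both statements reduce to
  evaluating the face sums on \<open>U\<^sub>1\<close>, \<open>A\<^sub>1\<close> and \<open>A\<^sub>2\<close>
  (\<open>Tot_homology_1_twisted_nontrivial\<close>, \<open>Tot_homology_1_twisted_trivial\<close>).
\<close>

section \<open>Homology of complexes with linear differentials\<close>

lemma (in chain_complex) mod_hom_bd:
  "mod_hom class_ring (chains X (q + 1)) (chains X q) (bd X (q + 1))"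
proof -
  have "bd X (q + 1) \<in> module_hom class_ring (chains X (q + 1)) (chains X q)"
    using bd_hom[of "q + 1"] by simp
  then show ?thesis
    using vectorspace_chains by (auto simp: mod_hom_def mod_hom_axioms_def vectorspace_def)
qed

lemma (in chain_complex) submodule_boundaries:
  "submodule class_ring (boundaries X q) (chains X q)"
proof -
  interpret d: mod_hom class_ring "chains X (q + 1)" "chains X q" "bd X (q + 1)"
    by (rule mod_hom_bd)
  show ?thesis
    using d.im_is_submodule by (simp add: d.im_def boundaries_def)
qed

lemma (in chain_complex) submodule_cycles:
  "submodule class_ring (cycles X q) (chains X q)"
proof -
  interpret d: mod_hom class_ring "chains X q" "chains X (q - 1)" "bd X q"
    using mod_hom_bd[of "q - 1"] by simp
  show ?thesis
    using d.ker_is_submodule by (simp add: d.ker_def cycles_def a_kernel_def')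
qed

lemma (in chain_complex) boundaries_subset_cycles: "boundaries X q \<subseteq> cycles X q"
proof
  fix y assume "y \<in> boundaries X q"
  then obtain x where x: "x \<in> carrier (chains X (q + 1))" "y = bd X (q + 1) x"
    by (auto simp: boundaries_def)
  have "y \<in> carrier (chains X q)"
    using x bd_hom[of "q + 1"] by (auto dest: LinearCombinations.module_hom_closed)
  moreover have "bd X q y = \<zero>\<^bsub>chains X (q - 1)\<^esub>"
    using bd_bd[OF x(1)] x(2) by simp
  ultimately show "y \<in> cycles X q"
    by (simp add: cycles_def a_kernel_def')
qed

lemma submodule_imp_abelian_subgroup:
  assumes "submodule R W M"
  shows "abelian_subgroup W M"
proof -
  interpret submodule R W M by fact
  interpret M: Module.module R M by (rule module)
  have "subgroup W (add_monoid M)"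
  proof (rule M.add.subgroupI)
    show "W \<subseteq> carrier M" by (rule subset)
    show "W \<noteq> {}" using zero_closed by blast
    show "\<ominus>\<^bsub>M\<^esub> a \<in> W" if "a \<in> W" for a
      using smult_closed[OF _ that, of "\<ominus>\<^bsub>R\<^esub> \<one>\<^bsub>R\<^esub>"] M.smult_minus_1[of a] subset that
      by (metis M.R.add.inv_closed M.R.one_closed subsetD)
    show "a \<oplus>\<^bsub>M\<^esub> b \<in> W" if "a \<in> W" "b \<in> W" for a b
      using that by (rule m_closed)
  qed
  then show ?thesis
    by (intro abelian_subgroupI3 additive_subgroupI M.abelian_group_axioms)
qed

lemma submodule_in_submodule:
  assumes W: "submodule R W M" and Z: "submodule R Z M" and "W \<subseteq> Z"
  shows "submodule R W (M\<lparr>carrier := Z\<rparr>)"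
proof -
  interpret W: submodule R W M by fact
  interpret M: Module.module R M by (rule W.module)
  show ?thesis
    using M.submodule_is_module[OF Z] W.m_closed W.zero_closed W.smult_closed assms(3)
    by (intro submodule.intro) (simp_all del: W.zero_closed W.m_closed W.smult_closed)
qed

text \<open>
  Scalar multiples of cosets are defined by a union over representatives; this is what makes the
  scalar multiplication of a quotient space well defined.
\<close>

lemma (in submodule) coset_smult:
  assumes c: "c \<in> carrier R" and y: "y \<in> carrier M"
  shows "(\<Union>x\<in>N +> y. N +> (c \<odot> x)) = N +> (c \<odot> y)"
proof -
  interpret M: Module.module R M by (rule module)
  interpret abelian_subgroup N M
    using submodule_imp_abelian_subgroup submodule_axioms by blast
  have "N +> (c \<odot> x) = N +> (c \<odot> y)" if x: "x \<in> N +> y" for x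
  proof -
    obtain w where w: "w \<in> N" "x = w \<oplus> y"
      using x by (auto simp: a_r_coset_def')
    have "c \<odot> x = c \<odot> w \<oplus> c \<odot> y"
      using c y by (simp add: w(2) M.smult_r_distr[OF c subsetD[OF subset w(1)] y])
    then have "c \<odot> x \<in> N +> (c \<odot> y)"
      using w c by (auto simp: a_r_coset_def')
    then show ?thesis
      using a_repr_independence' c y M.smult_closed by metis
  qed
  moreover have "y \<in> N +> y" using y by (rule a_rcos_self)
  ultimately show ?thesis by blast
qed

text \<open>
  Both \<open>homology_map\<close> and the quotient operations are unions over representatives, so the work is
  to see that cosets are independent of these and that cosets of cycles are closed under the
  operations.
\<close>

lemma (in chain_complex) quasi_iso_identity: "quasi_iso X X (\<lambda>q x. x)"
  unfolding quasi_iso_def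
proof (intro conjI allI)
  show "chain_map X X (\<lambda>q x. x)"
    by (auto simp: chain_map_def LinearCombinations.module_hom_def)
  fix q
  let ?B = "boundaries X q" and ?Z = "chains X q\<lparr>carrier := cycles X q\<rparr>"
  interpret B: submodule class_ring ?B ?Z
    by (intro submodule_in_submodule submodule_boundaries submodule_cycles
        boundaries_subset_cycles)
  interpret Z: Module.module class_ring ?Z by (rule B.module)
  interpret abelian_subgroup ?B ?Z
    using submodule_imp_abelian_subgroup B.submodule_axioms by blast
  have carrier_H: "carrier (homology X q) = a_rcosets\<^bsub>?Z\<^esub> ?B"
    by (simp add: homology_def quotient_vs_def)
  have cosets: "\<exists>y \<in> cycles X q. S = ?B +>\<^bsub>?Z\<^esub> y" if "S \<in> carrier (homology X q)" for S
    using that by (auto simp: carrier_H A_RCOSETS_def')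
  have coset_eq: "?B +>\<^bsub>chains X q\<^esub> x = ?B +>\<^bsub>?Z\<^esub> x" for x
    by (simp add: a_r_coset_def')
  have fixed: "homology_map X X (\<lambda>q x. x) q S = S" if S: "S \<in> carrier (homology X q)" for S
  proof -
    obtain y where y: "y \<in> cycles X q" "S = ?B +>\<^bsub>?Z\<^esub> y" using cosets[OF S] by blast
    have "?B +>\<^bsub>?Z\<^esub> x = S" if "x \<in> S" for x
      using a_repr_independence'[of x y] that y by auto
    moreover have "y \<in> S" using a_rcos_self[of y] y by simp
    ultimately show ?thesis by (auto simp: homology_map_def coset_eq)
  qed
  have add_closed: "S \<oplus>\<^bsub>homology X q\<^esub> T \<in> carrier (homology X q)"
    if "S \<in> carrier (homology X q)" "T \<in> carrier (homology X q)" for S T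
    using a_setmult_closed[of S T] that
    by (simp add: homology_def quotient_vs_def)
  have smult_closed: "c \<odot>\<^bsub>homology X q\<^esub> S \<in> carrier (homology X q)"
    if S: "S \<in> carrier (homology X q)" for c S
  proof -
    obtain y where y: "y \<in> cycles X q" "S = ?B +>\<^bsub>?Z\<^esub> y" using cosets[OF S] by blast
    have "c \<odot>\<^bsub>homology X q\<^esub> S = ?B +>\<^bsub>?Z\<^esub> (c \<odot>\<^bsub>?Z\<^esub> y)"
      using B.coset_smult[of c y] y by (simp add: homology_def quotient_vs_def)
    also have "\<dots> \<in> a_rcosets\<^bsub>?Z\<^esub> ?B"
      using y Z.smult_closed[of c y] by (auto simp: A_RCOSETS_def')
    finally show ?thesis by (simp add: carrier_H)
  qed
  show "vs_iso (homology X q) (homology X q) (homology_map X X (\<lambda>q x. x) q)"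
    unfolding vs_iso_def LinearCombinations.module_hom_def bij_betw_def
    using fixed add_closed smult_closed by (auto simp: inj_on_def)
qed

text \<open>
  A singleton carrier means that the homology vanishes; being a singleton is the invariant that
  distinguishes the two total homologies. If all cycles are boundaries, their cosets agree with the
  subspace of boundaries; conversely, every cycle lies in its own coset.
\<close>

lemma homology_trivial_iff:
  assumes B: "submodule class_ring (boundaries X q) (chains X q)"
    and zero: "\<zero>\<^bsub>chains X q\<^esub> \<in> cycles X q"
  shows "is_singleton (carrier (homology X q)) \<longleftrightarrow> cycles X q \<subseteq> boundaries X q"
proof -
  let ?B = "boundaries X q"
  interpret B: submodule class_ring ?B "chains X q" by fact
  interpret M: Module.module class_ring "chains X q" by (rule B.module)
  interpret abelian_subgroup ?B "chains X q"
    using submodule_imp_abelian_subgroup B by blast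
  have sub: "cycles X q \<subseteq> carrier (chains X q)" by (auto simp: cycles_def a_kernel_def')
  have H: "carrier (homology X q) = (\<lambda>x. ?B +>\<^bsub>chains X q\<^esub> x) ` cycles X q"
    by (auto simp: homology_def quotient_vs_def A_RCOSETS_def' a_r_coset_def')
  have B0: "?B +>\<^bsub>chains X q\<^esub> \<zero>\<^bsub>chains X q\<^esub> = ?B"
    by (rule a_rcos_const) simp
  show ?thesis
  proof
    assume "is_singleton (carrier (homology X q))"
    then obtain S where S: "carrier (homology X q) = {S}" by (rule is_singletonE)
    have coset: "?B +>\<^bsub>chains X q\<^esub> x = S" if "x \<in> cycles X q" for x
      using imageI[OF that, of "\<lambda>x. ?B +>\<^bsub>chains X q\<^esub> x"] S unfolding H by simp
    have "?B +>\<^bsub>chains X q\<^esub> x = ?B" if "x \<in> cycles X q" for x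
      using coset[OF that] coset[OF zero] B0 by simp
    then show "cycles X q \<subseteq> ?B" using a_rcos_self sub by blast
  next
    assume "cycles X q \<subseteq> ?B"
    then have "carrier (homology X q) = {?B}"
      unfolding H using zero a_rcos_const by auto
    then show "is_singleton (carrier (homology X q))" by (simp add: is_singleton_def)
  qed
qed

lemma vs_iso_is_singleton:
  assumes "vs_iso V W f" "is_singleton (carrier V)"
  shows "is_singleton (carrier W)"
  using assms by (auto simp: vs_iso_def bij_betw_def is_singleton_def dest!: sym[of "_ ` _"])

section \<open>The total complex\<close>

context simplicial_chain_complex
begin

lemma module_level: "Module.module class_ring (chains (level X p) q)"
  using chain_complex.vectorspace_chains[OF chain_complex_level] by (simp add: vectorspace_def)

lemma bd_level_hom:
  "bd (level X p) q \<in>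
    module_hom class_ring (chains (level X p) q) (chains (level X p) (q - 1))"
  using chain_complex.bd_hom[OF chain_complex_level] .

text \<open>
  All axioms hold pointwise in \<open>p\<close>; the point is that finite support is preserved.
\<close>

lemma vectorspace_Tot_chains: "vectorspace class_ring (Tot_chains X k)"
proof -
  let ?c = "\<lambda>p. chains (level X p) (k - int p)"
  interpret P: Module.module "class_ring :: complex ring" "?c p" for p by (rule module_level)
  have carrier_iff: "u \<in> carrier (Tot_chains X k) \<longleftrightarrow>
    (\<forall>p. u p \<in> carrier (?c p)) \<and> finite {p. u p \<noteq> \<zero>\<^bsub>?c p\<^esub>}" for u
    by (simp add: Tot_chains_def)
  have ops: "(u \<oplus>\<^bsub>Tot_chains X k\<^esub> v) = (\<lambda>p. u p \<oplus>\<^bsub>?c p\<^esub> v p)"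
    "c \<odot>\<^bsub>Tot_chains X k\<^esub> u = (\<lambda>p. c \<odot>\<^bsub>?c p\<^esub> u p)"
    "\<zero>\<^bsub>Tot_chains X k\<^esub> = (\<lambda>p. \<zero>\<^bsub>?c p\<^esub>)" for u v c
    by (simp_all add: Tot_chains_def)
  have fin_add: "finite {p. u p \<oplus>\<^bsub>?c p\<^esub> v p \<noteq> \<zero>\<^bsub>?c p\<^esub>}"
    if "finite {p. u p \<noteq> \<zero>\<^bsub>?c p\<^esub>}" "finite {p. v p \<noteq> \<zero>\<^bsub>?c p\<^esub>}" for u v
    by (rule finite_subset[OF _ finite_UnI[OF that]]) auto
  have fin_smult: "finite {p. c \<odot>\<^bsub>?c p\<^esub> u p \<noteq> \<zero>\<^bsub>?c p\<^esub>}"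
    if "finite {p. u p \<noteq> \<zero>\<^bsub>?c p\<^esub>}" for u c
    using P.smult_r_null by (intro finite_subset[OF _ that]) auto
  show ?thesis
  proof (rule vs_criteria; (intro allI ballI impI)?; (elim conjE)?)
    show "field (class_ring :: complex ring)" by (rule class_field)
  next
    show "\<zero>\<^bsub>Tot_chains X k\<^esub> \<in> carrier (Tot_chains X k)"
      by (simp add: carrier_iff ops)
  next
    fix v w assume "v \<in> carrier (Tot_chains X k)" "w \<in> carrier (Tot_chains X k)"
    then show "v \<oplus>\<^bsub>Tot_chains X k\<^esub> w \<in> carrier (Tot_chains X k)"
      "v \<oplus>\<^bsub>Tot_chains X k\<^esub> w = w \<oplus>\<^bsub>Tot_chains X k\<^esub> v"
      by (auto simp: carrier_iff ops fin_add P.M.a_comm)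
  next
    fix v assume v: "v \<in> carrier (Tot_chains X k)"
    have "finite {p. \<ominus>\<^bsub>?c p\<^esub> v p \<noteq> \<zero>\<^bsub>?c p\<^esub>}"
      by (rule finite_subset[of _ "{p. v p \<noteq> \<zero>\<^bsub>?c p\<^esub>}"]) (use v in \<open>auto simp: carrier_iff\<close>)
    with v show "\<exists>w\<in>carrier (Tot_chains X k). v \<oplus>\<^bsub>Tot_chains X k\<^esub> w = \<zero>\<^bsub>Tot_chains X k\<^esub>"
      by (intro bexI[of _ "\<lambda>p. \<ominus>\<^bsub>?c p\<^esub> v p"]) (auto simp: carrier_iff ops P.M.r_neg)
    from v show "v \<oplus>\<^bsub>Tot_chains X k\<^esub> \<zero>\<^bsub>Tot_chains X k\<^esub> = v"
      "\<one>\<^bsub>class_ring\<^esub> \<odot>\<^bsub>Tot_chains X k\<^esub> v = v"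
      using P.smult_one by (auto simp: carrier_iff ops)
  next
    fix c :: complex and v assume "v \<in> carrier (Tot_chains X k)"
    then show "c \<odot>\<^bsub>Tot_chains X k\<^esub> v \<in> carrier (Tot_chains X k)"
      using P.smult_closed by (simp add: carrier_iff ops fin_smult)
  next
    fix u v w
    assume "u \<in> carrier (Tot_chains X k)" "v \<in> carrier (Tot_chains X k)"
      "w \<in> carrier (Tot_chains X k)"
    then show "u \<oplus>\<^bsub>Tot_chains X k\<^esub> v \<oplus>\<^bsub>Tot_chains X k\<^esub> w =
      u \<oplus>\<^bsub>Tot_chains X k\<^esub> (v \<oplus>\<^bsub>Tot_chains X k\<^esub> w)"
      by (simp add: carrier_iff ops P.M.a_assoc)
  next
    fix a b :: complex and v assume "v \<in> carrier (Tot_chains X k)"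
    then show "(a \<otimes>\<^bsub>class_ring\<^esub> b) \<odot>\<^bsub>Tot_chains X k\<^esub> v =
      a \<odot>\<^bsub>Tot_chains X k\<^esub> (b \<odot>\<^bsub>Tot_chains X k\<^esub> v)"
      "(a \<oplus>\<^bsub>class_ring\<^esub> b) \<odot>\<^bsub>Tot_chains X k\<^esub> v =
      a \<odot>\<^bsub>Tot_chains X k\<^esub> v \<oplus>\<^bsub>Tot_chains X k\<^esub> b \<odot>\<^bsub>Tot_chains X k\<^esub> v"
      using P.smult_assoc1[of a b] P.smult_l_distr[of a b]
      by (simp_all add: carrier_iff ops)
  next
    fix a :: complex and v w
    assume "v \<in> carrier (Tot_chains X k)" "w \<in> carrier (Tot_chains X k)"
    then show "a \<odot>\<^bsub>Tot_chains X k\<^esub> (v \<oplus>\<^bsub>Tot_chains X k\<^esub> w) =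
      a \<odot>\<^bsub>Tot_chains X k\<^esub> v \<oplus>\<^bsub>Tot_chains X k\<^esub> a \<odot>\<^bsub>Tot_chains X k\<^esub> w"
      using P.smult_r_distr[of a] by (simp add: carrier_iff ops)
  qed
qed

lemma coface_simplex_hom: "i \<le> Suc n \<Longrightarrow> coface n i \<in> simplex_hom n (Suc n)"
  by (auto simp: coface_def simplex_hom_def mono_on_def)

lemma act_hom: "\<alpha> \<in> simplex_hom m n \<Longrightarrow>
    act X m n \<alpha> q \<in> module_hom class_ring (chains (level X n) q) (chains (level X m) q)"
  using chain_map_act by (auto simp: chain_map_def)

lemma face_sum_hom:
  "face_sum X q p \<in> module_hom class_ring (chains (level X (Suc p)) q) (chains (level X p) q)"
proof -
  let ?M = "chains (level X p) q" and ?N = "chains (level X (Suc p)) q"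
  let ?f = "\<lambda>i. act X p (Suc p) (coface p i) q"
  interpret M: Module.module class_ring ?M by (rule module_level)
  have face: "?f i \<in> module_hom class_ring ?N ?M" if "i \<le> Suc p" for i
    using act_hom[OF coface_simplex_hom[OF that]] .
  have f_closed: "?f i x \<in> carrier ?M" if "x \<in> carrier ?N" "i \<le> Suc p" for i x
    using LinearCombinations.module_hom_closed[OF face[OF that(2)]] that(1) by auto
  have term_closed: "(- 1) ^ i \<odot>\<^bsub>?M\<^esub> ?f i x \<in> carrier ?M" if "x \<in> carrier ?N" "i \<le> Suc p" for i x
    using f_closed[OF that] M.smult_closed by simp
  show ?thesis
    unfolding LinearCombinations.module_hom_def
  proof (intro CollectI conjI allI impI funcsetI; (elim conjE)?)
    fix x assume "x \<in> carrier ?N"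
    then show "face_sum X q p x \<in> carrier ?M"
      unfolding face_sum_def by (intro M.finsum_closed funcsetI term_closed) auto
  next
    fix x y assume xy: "x \<in> carrier ?N" "y \<in> carrier ?N"
    have "face_sum X q p (x \<oplus>\<^bsub>?N\<^esub> y) =
      (\<Oplus>\<^bsub>?M\<^esub>i\<in>{..Suc p}. ((- 1) ^ i \<odot>\<^bsub>?M\<^esub> ?f i x) \<oplus>\<^bsub>?M\<^esub> ((- 1) ^ i \<odot>\<^bsub>?M\<^esub> ?f i y))"
      unfolding face_sum_def
      using xy f_closed
      by (intro M.finsum_cong') (auto simp: LinearCombinations.module_hom_add[OF face] M.smult_r_distr)
    also have "\<dots> = face_sum X q p x \<oplus>\<^bsub>?M\<^esub> face_sum X q p y"
      unfolding face_sum_def using xy term_closed by (intro M.finsum_addf) auto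
    finally show "face_sum X q p (x \<oplus>\<^bsub>?N\<^esub> y) = face_sum X q p x \<oplus>\<^bsub>?M\<^esub> face_sum X q p y" .
  next
    fix c :: complex and x assume x: "x \<in> carrier ?N"
    have "face_sum X q p (c \<odot>\<^bsub>?N\<^esub> x) =
      (\<Oplus>\<^bsub>?M\<^esub>i\<in>{..Suc p}. c \<odot>\<^bsub>?M\<^esub> ((- 1) ^ i \<odot>\<^bsub>?M\<^esub> ?f i x))"
      unfolding face_sum_def
      using x f_closed term_closed M.smult_assoc1
      by (intro M.finsum_cong') (auto simp: LinearCombinations.module_hom_smult[OF face]
          mult.commute simp flip: M.smult_assoc1[simplified])
    also have "\<dots> = c \<odot>\<^bsub>?M\<^esub> face_sum X q p x"
      unfolding face_sum_def using x term_closed by (intro M.finsum_smult[symmetric]) auto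
    finally show "face_sum X q p (c \<odot>\<^bsub>?N\<^esub> x) = c \<odot>\<^bsub>?M\<^esub> face_sum X q p x" .
  qed
qed

text \<open>
  For finite support: \<open>Tot_bd X k u p\<close> depends on \<open>u p\<close> and \<open>u (Suc p)\<close> only.
\<close>

lemma Tot_bd_hom: "Tot_bd X k \<in> module_hom class_ring (Tot_chains X k) (Tot_chains X (k - 1))"
proof -
  let ?c = "\<lambda>p. chains (level X p) (k - int p)"
  let ?d = "\<lambda>p. chains (level X p) (k - 1 - int p)"
  have M: "Module.module class_ring (chains (level X p) q)" for p q by (rule module_level)
  note G = Module.module.axioms(2)[OF M]
  note A = abelian_group.axioms(1)[OF G]
  have bd: "bd (level X p) (k - int p) \<in> module_hom class_ring (?c p) (?d p)" for p
    using bd_level_hom[of p "k - int p"] by (simp add: algebra_simps)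
  have fs: "face_sum X (k - 1 - int p) p \<in> module_hom class_ring (?c (Suc p)) (?d p)" for p
    using face_sum_hom[of "k - 1 - int p" p] by (simp add: algebra_simps)
  have hom: "(\<lambda>u. Tot_bd X k u p) \<in> module_hom class_ring (Tot_chains X k) (?d p)" for p
  proof -
    interpret D: Module.module class_ring "?d p" by (rule M)
    have cl: "bd (level X p) (k - int p) x \<in> carrier (?d p)" if "x \<in> carrier (?c p)" for x
      using LinearCombinations.module_hom_closed[OF bd] that by auto
    have cl': "face_sum X (k - 1 - int p) p x \<in> carrier (?d p)" if "x \<in> carrier (?c (Suc p))" for x
      using LinearCombinations.module_hom_closed[OF fs] that by (auto simp del: of_nat_Suc)
    have eq: "((a \<oplus>\<^bsub>?d p\<^esub> b) \<oplus>\<^bsub>?d p\<^esub> (c \<oplus>\<^bsub>?d p\<^esub> d)) = (a \<oplus>\<^bsub>?d p\<^esub> c) \<oplus>\<^bsub>?d p\<^esub> (b \<oplus>\<^bsub>?d p\<^esub> d)"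
      if "a \<in> carrier (?d p)" "b \<in> carrier (?d p)" "c \<in> carrier (?d p)" "d \<in> carrier (?d p)" for a b c d
      using that by (simp add: D.a_ac)
    show ?thesis
      unfolding LinearCombinations.module_hom_def
      by (auto simp: Tot_bd_def Tot_chains_def
          LinearCombinations.module_hom_add[OF bd] LinearCombinations.module_hom_add[OF fs]
          LinearCombinations.module_hom_smult[OF bd] LinearCombinations.module_hom_smult[OF fs]
          cl cl' D.smult_r_distr eq
          mult.commute simp del: of_nat_Suc simp flip: D.smult_assoc1[simplified])
  qed
  have zero: "f \<zero>\<^bsub>N\<^esub> = \<zero>\<^bsub>N'\<^esub>"
    if "f \<in> module_hom class_ring N N'" "Module.module class_ring N" "Module.module class_ring N'"
    for f and N :: "(complex, 'b) module" and N' :: "(complex, 'c) module"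
    using that by (intro mod_hom.f0_is_0[of class_ring]) (auto simp: mod_hom_def mod_hom_axioms_def)
  have supp: "finite {p. Tot_bd X k u p \<noteq> \<zero>\<^bsub>?d p\<^esub>}" if u: "u \<in> carrier (Tot_chains X k)" for u
  proof (rule finite_subset)
    let ?S = "{p. u p \<noteq> \<zero>\<^bsub>?c p\<^esub>}"
    show "finite (?S \<union> Suc -` ?S)"
      using u by (intro finite_UnI finite_vimageI) (auto simp: Tot_chains_def)
    show "{p. Tot_bd X k u p \<noteq> \<zero>\<^bsub>?d p\<^esub>} \<subseteq> ?S \<union> Suc -` ?S"
      using Module.module.smult_r_null[OF M]
      by (auto simp: Tot_bd_def zero[OF bd M M] zero[OF fs M M]
          abelian_monoid.l_zero[OF A] abelian_monoid.zero_closed[OF A] simp del: of_nat_Suc)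
  qed
  show ?thesis
    unfolding LinearCombinations.module_hom_def
  proof (intro CollectI conjI allI impI funcsetI; (elim conjE)?)
    fix u assume u: "u \<in> carrier (Tot_chains X k)"
    have "Tot_bd X k u p \<in> carrier (?d p)" for p
      using LinearCombinations.module_hom_closed[OF hom] u by auto
    with supp[OF u] show "Tot_bd X k u \<in> carrier (Tot_chains X (k - 1))"
      by (simp add: Tot_chains_def)
    show "Tot_bd X k (c \<odot>\<^bsub>Tot_chains X k\<^esub> u) = c \<odot>\<^bsub>Tot_chains X (k - 1)\<^esub> Tot_bd X k u" for c
      using LinearCombinations.module_hom_smult[OF hom _ u, of c]
      by (auto simp: Tot_chains_def[of X "k - 1"])
  next
    fix u v assume "u \<in> carrier (Tot_chains X k)" "v \<in> carrier (Tot_chains X k)"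
    from LinearCombinations.module_hom_add[OF hom this]
    show "Tot_bd X k (u \<oplus>\<^bsub>Tot_chains X k\<^esub> v) =
      Tot_bd X k u \<oplus>\<^bsub>Tot_chains X (k - 1)\<^esub> Tot_bd X k v"
      by (auto simp: Tot_chains_def[of X "k - 1"])
  qed
qed

lemma submodule_Tot_boundaries:
  "submodule class_ring (boundaries (Tot X) k) (chains (Tot X) k)"
proof -
  interpret d: mod_hom class_ring "Tot_chains X (k + 1)" "Tot_chains X k" "Tot_bd X (k + 1)"
    using vectorspace_Tot_chains Tot_bd_hom[of "k + 1"]
    by (auto simp: mod_hom_def mod_hom_axioms_def vectorspace_def)
  show ?thesis
    using d.im_is_submodule by (simp add: d.im_def boundaries_def Tot_def)
qed

lemma zero_mem_Tot_cycles: "\<zero>\<^bsub>chains (Tot X) k\<^esub> \<in> cycles (Tot X) k"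
proof -
  interpret d: mod_hom class_ring "Tot_chains X k" "Tot_chains X (k - 1)" "Tot_bd X k"
    using vectorspace_Tot_chains Tot_bd_hom
    by (auto simp: mod_hom_def mod_hom_axioms_def vectorspace_def)
  show ?thesis
    by (simp add: cycles_def a_kernel_def' Tot_def)
qed

lemma Tot_homology_trivial_iff:
  "is_singleton (carrier (homology (Tot X) k)) \<longleftrightarrow> cycles (Tot X) k \<subseteq> boundaries (Tot X) k"
  by (intro homology_trivial_iff submodule_Tot_boundaries zero_mem_Tot_cycles)

end

section \<open>Spaces of complex functions\<close>

definition fun_space :: "('i \<Rightarrow> complex) set \<Rightarrow> (complex, 'i \<Rightarrow> complex) module" where
  "fun_space S =
    \<lparr>carrier = S, mult = (\<lambda>_ _ _. 0), one = (\<lambda>_. 0), zero = (\<lambda>_. 0),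
     add = (\<lambda>f g j. f j + g j), smult = (\<lambda>c f j. c * f j)\<rparr>"

definition linear_set :: "('i \<Rightarrow> complex) set \<Rightarrow> bool" where
  "linear_set S \<longleftrightarrow> (\<lambda>_. 0) \<in> S \<and> (\<forall>f\<in>S. \<forall>g\<in>S. (\<lambda>j. f j + g j) \<in> S) \<and>
    (\<forall>c. \<forall>f\<in>S. (\<lambda>j. c * f j) \<in> S)"

lemma fun_space_simps [simp]:
  "carrier (fun_space S) = S"
  "\<zero>\<^bsub>fun_space S\<^esub> = (\<lambda>_. 0)"
  "f \<oplus>\<^bsub>fun_space S\<^esub> g = (\<lambda>j. f j + g j)"
  "c \<odot>\<^bsub>fun_space S\<^esub> f = (\<lambda>j. c * f j)"
  by (simp_all add: fun_space_def)

lemma linear_set_uminus: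
  assumes "linear_set S" "f \<in> S"
  shows "(\<lambda>j. - f j) \<in> S"
proof -
  have "(\<lambda>j. - 1 * f j) \<in> S" using assms unfolding linear_set_def by blast
  then show ?thesis by simp
qed

lemma vectorspace_fun_space:
  assumes S: "linear_set S"
  shows "vectorspace class_ring (fun_space S)"
proof (rule vs_criteria)
  show "\<forall>v\<in>carrier (fun_space S). \<exists>w\<in>carrier (fun_space S). v \<oplus>\<^bsub>fun_space S\<^esub> w = \<zero>\<^bsub>fun_space S\<^esub>"
  proof
    fix v assume "v \<in> carrier (fun_space S)"
    then show "\<exists>w\<in>carrier (fun_space S). v \<oplus>\<^bsub>fun_space S\<^esub> w = \<zero>\<^bsub>fun_space S\<^esub>"
      using linear_set_uminus[OF S] by (intro bexI[of _ "\<lambda>j. - v j"]) auto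
  qed
qed (use S class_field in \<open>auto simp: linear_set_def algebra_simps\<close>)

lemma minus_fun_space:
  assumes S: "linear_set S" and "f \<in> S" "g \<in> S"
  shows "f \<ominus>\<^bsub>fun_space S\<^esub> g = (\<lambda>j. f j - g j)"
proof -
  interpret V: vectorspace class_ring "fun_space S" by (rule vectorspace_fun_space[OF S])
  have "\<ominus>\<^bsub>fun_space S\<^esub> g = (\<lambda>j. - g j)"
    using assms linear_set_uminus[OF S] by (intro V.minus_equality) auto
  then show ?thesis by (simp add: a_minus_def)
qed

lemma finsum_fun_space:
  assumes S: "linear_set S" and "finite A" "f \<in> A \<rightarrow> S"
  shows "finsum (fun_space S) f A = (\<lambda>j. \<Sum>i\<in>A. f i j)"
proof -
  interpret V: vectorspace class_ring "fun_space S" by (rule vectorspace_fun_space[OF S])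
  show ?thesis
    using assms(2,3) by (induction A) (auto simp: V.finsum_insert)
qed

lemma fun_space_homI:
  assumes "\<And>f. f \<in> S \<Longrightarrow> F f \<in> T"
    and "\<And>f g j. F (\<lambda>i. f i + g i) j = F f j + F g j"
    and "\<And>c f j. F (\<lambda>i. c * f i) j = c * F f j"
  shows "F \<in> module_hom class_ring (fun_space S) (fun_space T)"
  using assms by (auto simp: LinearCombinations.module_hom_def)

section \<open>The twisted simplicial structures\<close>

text \<open>
  Elements of a level must have type \<open>nat \<Rightarrow> complex\<close>, so functions of two vertices are stored along
  the pairing bijection \<open>prod_encode\<close>.
\<close>

definition pair_fun :: "(nat \<Rightarrow> nat \<Rightarrow> complex) \<Rightarrow> nat \<Rightarrow> complex" where
  "pair_fun g k = g (fst (prod_decode k)) (snd (prod_decode k))"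

lemma pair_fun_encode [simp]: "pair_fun g (prod_encode (i, j)) = g i j"
  by (simp add: pair_fun_def)

lemma pair_fun_eqI:
  assumes "\<And>i j. f (prod_encode (i, j)) = g (prod_encode (i, j))"
  shows "f = g"
proof
  fix k
  show "f k = g k" using assms[of "fst (prod_decode k)" "snd (prod_decode k)"] by simp
qed

text \<open>
  A function on \<open>[n]\<close> is represented by its extension to all natural numbers that is constant from
  \<open>n\<close> on, rather than by zero. Constants then stay constants, and the coboundary is given by the
  same formula on every level.
\<close>

definition cochain_space :: "nat \<Rightarrow> int \<Rightarrow> (nat \<Rightarrow> complex) set" where
  "cochain_space n q =
    (if q = 1 then {f. \<forall>j. f (min j n) = f j}
     else if q = 0 then {f. \<forall>i j. f (prod_encode (min i n, min j n)) = f (prod_encode (i, j))}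
     else {\<lambda>_. 0})"

definition coboundary :: "int \<Rightarrow> (nat \<Rightarrow> complex) \<Rightarrow> nat \<Rightarrow> complex" where
  "coboundary q f = (if q = 1 then pair_fun (\<lambda>i j. f j - f i) else (\<lambda>_. 0))"

text \<open>
  Clamping to \<open>min j m\<close> keeps \<open>\<alpha>\<close> inside its domain and makes the result constant from \<open>m\<close> on.
\<close>

definition twisted_pullback ::
    "complex \<Rightarrow> nat \<Rightarrow> (nat \<Rightarrow> nat) \<Rightarrow> int \<Rightarrow> (nat \<Rightarrow> complex) \<Rightarrow> nat \<Rightarrow> complex" where
  "twisted_pullback t m \<alpha> q f =
    (if q = 1 then (\<lambda>j. f (\<alpha> (min j m)) + t * (f 0 - f (\<alpha> 0)))
     else if q = 0 then pair_fun (\<lambda>i j. f (prod_encode (\<alpha> (min i m), \<alpha> (min j m))))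
     else (\<lambda>_. 0))"

definition cochain_cx :: "nat \<Rightarrow> (nat \<Rightarrow> complex) graded_cx" where
  "cochain_cx n = \<lparr>chains = (\<lambda>q. fun_space (cochain_space n q)), bd = coboundary\<rparr>"

definition twisted :: "complex \<Rightarrow> (nat \<Rightarrow> complex) simplicial_obj" where
  "twisted t = \<lparr>level = cochain_cx, act = (\<lambda>m n. twisted_pullback t m)\<rparr>"

lemma cochain_cx_simps [simp]:
  "chains (cochain_cx n) q = fun_space (cochain_space n q)"
  "bd (cochain_cx n) q = coboundary q"
  by (simp_all add: cochain_cx_def)

lemma twisted_simps [simp]:
  "level (twisted t) n = cochain_cx n"
  "act (twisted t) m n \<alpha> = twisted_pullback t m \<alpha>"
  by (simp_all add: twisted_def)

lemma linear_set_cochain_space: "linear_set (cochain_space n q)"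
  by (simp add: linear_set_def cochain_space_def)

lemma coboundary_closed: "f \<in> cochain_space n q \<Longrightarrow> coboundary q f \<in> cochain_space n (q - 1)"
  by (auto simp: cochain_space_def coboundary_def)

lemma simplex_homD:
  assumes "\<alpha> \<in> simplex_hom m n"
  shows "\<alpha> (min j m) \<le> n" and "\<alpha> 0 \<le> n"
  using assms by (auto simp: simplex_hom_def)

lemma twisted_pullback_closed:
  "f \<in> cochain_space n q \<Longrightarrow> twisted_pullback t m \<alpha> q f \<in> cochain_space m q"
  by (auto simp: cochain_space_def twisted_pullback_def)

lemma chain_complex_cochain_cx: "chain_complex (cochain_cx n)"
proof (rule chain_complex.intro)
  show "vectorspace class_ring (chains (cochain_cx n) q)" for q
    by (simp add: vectorspace_fun_space linear_set_cochain_space)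
  show "bd (cochain_cx n) q \<in> module_hom class_ring (chains (cochain_cx n) q) (chains (cochain_cx n) (q - 1))" for q
    using coboundary_closed
    by (auto intro!: fun_space_homI simp: coboundary_def pair_fun_def algebra_simps)
  show "bd (cochain_cx n) (q - 1) (bd (cochain_cx n) q x) = \<zero>\<^bsub>chains (cochain_cx n) (q - 2)\<^esub>" for q x
    by (auto simp: coboundary_def pair_fun_def)
qed

lemma chain_map_twisted_pullback:
  "chain_map (cochain_cx n) (cochain_cx m) (twisted_pullback t m \<alpha>)"
  unfolding chain_map_def
proof (intro allI conjI ballI)
  fix q
  show "twisted_pullback t m \<alpha> q \<in>
      module_hom class_ring (chains (cochain_cx n) q) (chains (cochain_cx m) q)"
    using twisted_pullback_closed
    by (auto intro!: fun_space_homI simp: twisted_pullback_def pair_fun_def algebra_simps)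
  show "bd (cochain_cx m) q (twisted_pullback t m \<alpha> q f) =
      twisted_pullback t m \<alpha> (q - 1) (bd (cochain_cx n) q f)" for f
    by (rule pair_fun_eqI) (auto simp: coboundary_def twisted_pullback_def)
qed

lemma twisted_pullback_id:
  "f \<in> cochain_space n q \<Longrightarrow> twisted_pullback t n (\<lambda>j\<in>{..n}. j) q f = f"
  by (rule pair_fun_eqI) (auto simp: cochain_space_def twisted_pullback_def)

text \<open>
  The corrections telescope: with \<open>g = f \<circ> \<beta> + t (f 0 - f (\<beta> 0))\<close> the added constant cancels
  in \<open>g 0 - g (\<alpha> 0)\<close>, and \<open>t (f 0 - f (\<beta> 0)) + t (f (\<beta> 0) - f (\<beta> (\<alpha> 0)))\<close> is the
  correction of the composite.
\<close>

lemma twisted_pullback_compose: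
  assumes \<alpha>: "\<alpha> \<in> simplex_hom l m"
  shows "twisted_pullback t l (compose {..l} \<beta> \<alpha>) q f =
    twisted_pullback t l \<alpha> q (twisted_pullback t m \<beta> q f)"
proof -
  have "compose {..l} \<beta> \<alpha> (min j l) = \<beta> (min (\<alpha> (min j l)) m)" for j
    using simplex_homD(1)[OF \<alpha>, of j] by (simp add: compose_def min_absorb1)
  moreover have "compose {..l} \<beta> \<alpha> 0 = \<beta> (min (\<alpha> 0) m)"
    using simplex_homD(2)[OF \<alpha>] by (simp add: compose_def min_absorb1)
  ultimately show ?thesis
    by (intro pair_fun_eqI) (simp add: twisted_pullback_def algebra_simps)
qed

lemma simplicial_chain_complex_twisted: "simplicial_chain_complex (twisted t)"
proof (rule simplicial_chain_complex.intro)
  show "chain_complex (level (twisted t) n)" for n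
    by (simp add: chain_complex_cochain_cx)
  show "bounded_below (level (twisted t) n)" for n
    unfolding bounded_below_def by (intro exI[of _ 0]) (auto simp: cochain_space_def)
qed (simp_all add: chain_map_twisted_pullback twisted_pullback_id twisted_pullback_compose)

text \<open>
  The two actions differ in degree 1 by the constant \<open>(s - t) (f 0 - f (\<alpha> 0))\<close>, which is
  \<open>(t - s)\<close> times the value of the coboundary of \<open>f\<close> at \<open>(0, \<alpha> 0)\<close>. In degree 0 the homotopy
  produces a constant, which the coboundary kills, in agreement with the equality of the actions there.
\<close>

lemma chain_homotopy_twist:
  shows "chain_homotopy (cochain_cx n) (cochain_cx m)
    (twisted_pullback s m \<alpha>) (twisted_pullback t m \<alpha>)
    (\<lambda>q f. if q = 0 then (\<lambda>_. (t - s) * f (prod_encode (0, \<alpha> 0))) else (\<lambda>_. 0))"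
  unfolding chain_homotopy_def
proof (intro allI conjI ballI)
  fix q :: int
  let ?h = "\<lambda>q f. if q = (0::int) then (\<lambda>_. (t - s) * f (prod_encode (0, \<alpha> 0))) else (\<lambda>_::nat. 0)"
  show "?h q \<in> module_hom class_ring (chains (cochain_cx n) q) (chains (cochain_cx m) (q + 1))"
    by (auto intro!: fun_space_homI simp: cochain_space_def algebra_simps)
  fix f assume "f \<in> carrier (chains (cochain_cx n) q)"
  then have f: "f \<in> cochain_space n q" by simp
  have "twisted_pullback s m \<alpha> q f \<ominus>\<^bsub>chains (cochain_cx m) q\<^esub> twisted_pullback t m \<alpha> q f =
    (\<lambda>j. twisted_pullback s m \<alpha> q f j - twisted_pullback t m \<alpha> q f j)"
    by (simp add: minus_fun_space linear_set_cochain_space twisted_pullback_closed[OF f])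
  also have "\<dots> = (\<lambda>j. coboundary (q + 1) (?h q f) j + ?h (q - 1) (coboundary q f) j)"
    by (rule pair_fun_eqI) (auto simp: twisted_pullback_def coboundary_def algebra_simps)
  finally show "twisted_pullback s m \<alpha> q f \<ominus>\<^bsub>chains (cochain_cx m) q\<^esub> twisted_pullback t m \<alpha> q f =
    bd (cochain_cx m) (q + 1) (?h q f) \<oplus>\<^bsub>chains (cochain_cx m) q\<^esub> ?h (q - 1) (bd (cochain_cx n) q f)"
    by simp
qed

section \<open>The total homology in degree one\<close>

lemma face_sum_twisted:
  assumes "f \<in> cochain_space (Suc p) q"
  shows "face_sum (twisted t) q p f =
    (\<lambda>j. \<Sum>i\<le>Suc p. (- 1) ^ i * twisted_pullback t p (coface p i) q f j)"
proof -
  have "(\<lambda>i. (- 1) ^ i \<odot>\<^bsub>fun_space (cochain_space p q)\<^esub> twisted_pullback t p (coface p i) q f)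
    \<in> {..Suc p} \<rightarrow> cochain_space p q"
    using linear_set_cochain_space[of p q] twisted_pullback_closed[OF assms]
    by (auto simp: linear_set_def)
  then show ?thesis
    unfolding face_sum_def
    by (simp add: finsum_fun_space linear_set_cochain_space del: sum.atMost_Suc)
qed

text \<open>
  This map decides the total homology in degree 1: it is onto \<open>U\<^sub>0\<close> for \<open>t \<noteq> 1\<close> and zero for
  \<open>t = 1\<close>.
\<close>

lemma face_sum_twisted_1_0:
  assumes "f \<in> cochain_space 1 1"
  shows "face_sum (twisted t) 1 0 f = (\<lambda>_. (1 - t) * (f 1 - f 0))"
  using face_sum_twisted[of f 0 1 t] assms
  by (simp add: twisted_pullback_def coface_def algebra_simps)

lemma face_sum_twisted_0_0:
  assumes "f \<in> cochain_space 1 0"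
  shows "face_sum (twisted t) 0 0 f = (\<lambda>_. f (prod_encode (1, 1)) - f (prod_encode (0, 0)))"
  using face_sum_twisted[of f 0 0 t] assms
  by (simp add: twisted_pullback_def coface_def pair_fun_def)

text \<open>
  On \<open>{0, 1}\<close>, the three cofaces \<open>[1] \<rightarrow> [2]\<close> are \<open>k \<mapsto> k + 1\<close>, \<open>k \<mapsto> 2 k\<close> and
  \<open>k \<mapsto> k\<close>.
\<close>

lemma face_sum_twisted_0_1:
  assumes "f \<in> cochain_space 2 0"
  shows "face_sum (twisted t) 0 1 f = pair_fun (\<lambda>i j.
    f (prod_encode (Suc (min i 1), Suc (min j 1)))
    - f (prod_encode (2 * min i 1, 2 * min j 1))
    + f (prod_encode (min i 1, min j 1)))"
proof (rule pair_fun_eqI)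
  fix i j :: nat
  have d0: "coface 1 0 (min k 1) = Suc (min k 1)" for k by (simp add: coface_def)
  have d1: "coface 1 1 (min k 1) = 2 * min k 1" for k
    by (cases k) (simp_all add: coface_def)
  have d2: "coface 1 2 (min k 1) = min k 1" for k by (simp add: coface_def)
  have "face_sum (twisted t) 0 1 f (prod_encode (i, j)) =
     (\<Sum>k\<le>2. (- 1) ^ k * f (prod_encode (coface 1 k (min i 1), coface 1 k (min j 1))))"
    using face_sum_twisted[of f 1 0 t] assms
    by (simp add: twisted_pullback_def numeral_2_eq_2)
  also have "\<dots> = f (prod_encode (Suc (min i 1), Suc (min j 1)))
    - f (prod_encode (2 * min i 1, 2 * min j 1)) + f (prod_encode (min i 1, min j 1))"
    using d0 d1 d2 by (simp add: numeral_2_eq_2)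
  finally show "face_sum (twisted t) 0 1 f (prod_encode (i, j)) = pair_fun (\<lambda>i j.
    f (prod_encode (Suc (min i 1), Suc (min j 1)))
    - f (prod_encode (2 * min i 1, 2 * min j 1))
    + f (prod_encode (min i 1, min j 1))) (prod_encode (i, j))" by simp
qed

lemma Tot_bd_closed:
  assumes "u \<in> carrier (Tot_chains (twisted t) k)"
  shows "Tot_bd (twisted t) k u p \<in> cochain_space p (k - 1 - int p)"
proof -
  interpret simplicial_chain_complex "twisted t" by (rule simplicial_chain_complex_twisted)
  have "Tot_bd (twisted t) k u \<in> carrier (Tot_chains (twisted t) (k - 1))"
    using LinearCombinations.module_hom_closed[OF Tot_bd_hom] assms by blast
  then show ?thesis by (simp add: Tot_chains_def)
qed

lemma Tot_carrier_iff:
  "u \<in> carrier (Tot_chains (twisted t) k) \<longleftrightarrow>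
    (\<forall>p. u p \<in> cochain_space p (k - int p)) \<and> finite {p. u p \<noteq> (\<lambda>_. 0)}"
  by (simp add: Tot_chains_def)

lemma zero_mem_cochain_space: "(\<lambda>_. 0) \<in> cochain_space n q"
  by (simp add: cochain_space_def)

text \<open>
  The vertical differential vanishes on \<open>U\<^sub>0\<close>, where all functions are constant, so the only
  condition comes from the two faces \<open>A\<^sub>1 \<rightarrow> A\<^sub>0\<close>.
\<close>

lemma Tot_cycles_1_iff:
  "u \<in> cycles (Tot (twisted t)) 1 \<longleftrightarrow> u \<in> carrier (Tot_chains (twisted t) 1) \<and>
    u 1 (prod_encode (1, 1)) = u 1 (prod_encode (0, 0))"
proof -
  have "Tot_bd (twisted t) 1 u = (\<lambda>p. \<lambda>_. 0) \<longleftrightarrow>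
      u 1 (prod_encode (1, 1)) = u 1 (prod_encode (0, 0))"
    if u: "u \<in> carrier (Tot_chains (twisted t) 1)"
  proof -
    have u0: "u 0 \<in> cochain_space 0 1" and u1: "u 1 \<in> cochain_space 1 0"
      using u unfolding Tot_carrier_iff by (metis diff_zero of_nat_0, metis diff_self of_nat_1)
    have "coboundary 1 (u 0) = (\<lambda>_. 0)"
      using u0 by (intro pair_fun_eqI) (simp add: coboundary_def cochain_space_def, metis)
    then have "Tot_bd (twisted t) 1 u 0 =
        (\<lambda>_. u 1 (prod_encode (1, 1)) - u 1 (prod_encode (0, 0)))"
      using face_sum_twisted_0_0[OF u1, of t] by (simp add: Tot_bd_def)
    moreover have "Tot_bd (twisted t) 1 u p = (\<lambda>_. 0)" if "p \<noteq> 0" for p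
      using Tot_bd_closed[OF u, of p] that by (simp add: cochain_space_def)
    ultimately show ?thesis
      by (metis (no_types, lifting) eq_iff_diff_eq_0)
  qed
  then show ?thesis
    by (auto simp: cycles_def a_kernel_def' Tot_def) (simp_all add: Tot_chains_def)
qed

text \<open>
  The constant \<open>1\<close> in \<open>U\<^sub>0\<close> is a cycle, and a boundary has zero component in \<open>U\<^sub>0\<close>: level 0 has
  no chains in degree 2, and the face sum from \<open>U\<^sub>1\<close> is zero.
\<close>

lemma Tot_homology_1_twisted_nontrivial:
  "\<not> is_singleton (carrier (homology (Tot (twisted 1)) 1))"
proof -
  interpret simplicial_chain_complex "twisted 1" by (rule simplicial_chain_complex_twisted)
  define u :: "nat \<Rightarrow> nat \<Rightarrow> complex" where "u p = (\<lambda>_. if p = 0 then 1 else 0)" for p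
  have "{p. u p \<noteq> (\<lambda>_. 0)} \<subseteq> {0}" by (auto simp: u_def)
  then have "finite {p. u p \<noteq> (\<lambda>_. 0)}" by (rule finite_subset) simp
  then have u: "u \<in> cycles (Tot (twisted 1)) 1"
    by (simp add: Tot_cycles_1_iff Tot_carrier_iff) (simp add: u_def cochain_space_def)
  have "u \<notin> boundaries (Tot (twisted 1)) 1"
  proof
    assume "u \<in> boundaries (Tot (twisted 1)) 1"
    then obtain v where v: "v \<in> carrier (Tot_chains (twisted 1) 2)" "u = Tot_bd (twisted 1) 2 v"
      by (auto simp: boundaries_def Tot_def)
    have "v (Suc 0) \<in> cochain_space (Suc 0) (2 - int (Suc 0))"
      using v(1) unfolding Tot_carrier_iff by blast
    then have "face_sum (twisted 1) 1 0 (v (Suc 0)) = (\<lambda>_. 0)"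
      by (subst face_sum_twisted_1_0) simp_all
    then have "u 0 = (\<lambda>_. 0)"
      unfolding v(2) by (simp add: Tot_bd_def coboundary_def)
    then show False by (simp add: u_def fun_eq_iff)
  qed
  with u show ?thesis unfolding Tot_homology_trivial_iff by blast
qed

text \<open>
  A cycle has components \<open>u 0\<close> in \<open>U\<^sub>0\<close> and \<open>u 1\<close> in \<open>A\<^sub>1\<close>. First \<open>u 0\<close> is written as the face sum
  of some \<open>w\<close> in \<open>U\<^sub>1\<close>, which needs \<open>t \<noteq> 1\<close>. The remainder \<open>G = u 1 + \<delta> w\<close> in \<open>A\<^sub>1\<close> still has
  vanishing face sum, and a preimage of it in \<open>A\<^sub>2\<close> is obtained from the contraction of \<open>A\<close>:
  shift the vertices by one and extend by zero to the new vertex \<open>0\<close>.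
\<close>

lemma Tot_homology_1_twisted_trivial:
  assumes "t \<noteq> 1"
  shows "is_singleton (carrier (homology (Tot (twisted t)) 1))"
proof -
  interpret simplicial_chain_complex "twisted t" by (rule simplicial_chain_complex_twisted)
  have "u \<in> boundaries (Tot (twisted t)) 1" if "u \<in> cycles (Tot (twisted t)) 1" for u
  proof -
    have u: "u \<in> carrier (Tot_chains (twisted t) 1)"
      and eq: "u 1 (prod_encode (1, 1)) = u 1 (prod_encode (0, 0))"
      using that by (simp_all add: Tot_cycles_1_iff)
    have u_mem: "u p \<in> cochain_space p (1 - int p)" for p
      using u by (simp add: Tot_carrier_iff)
    have u0: "u 0 j = u 0 0" for j
      using u_mem[of 0] by (simp add: cochain_space_def) (metis)
    have u1: "u 1 (prod_encode (min i 1, min j 1)) = u 1 (prod_encode (i, j))" for i j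
      using u_mem[of 1] by (simp add: cochain_space_def)
    define w :: "nat \<Rightarrow> complex" where "w j = (if j = 0 then 0 else u 0 0 / (1 - t))" for j
    \<comment> \<open>The plus sign undoes the sign \<open>-1\<close> of the vertical differential on level 1.\<close>
    define G where "G i j = u 1 (prod_encode (i, j)) + (w j - w i)" for i j
    define v where "v p = (if p = 1 then w
       else if p = 2 then pair_fun (\<lambda>i j. if i = 0 \<or> j = 0 then 0 else G (i - 1) (j - 1))
       else (\<lambda>_. 0))" for p :: nat
    have w_min: "w (min j 1) = w j" for j by (simp add: w_def)
    have G_min: "G (min i 1) (min j 1) = G i j" for i j
      by (simp only: G_def u1 w_min)
    have G_diag: "G 1 1 = G 0 0" using eq by (simp add: G_def)
    have G_min2: "G (min i 2 - 1) (min j 2 - 1) = G (i - 1) (j - 1)" for i j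
    proof -
      have "min k 2 - 1 = min (k - 1) (1::nat)" for k by auto
      then show ?thesis by (simp only: G_min)
    qed
    have min2: "min i 2 = 0 \<longleftrightarrow> i = 0" for i :: nat by auto
    have v1: "v 1 \<in> cochain_space 1 1"
      using w_min by (simp add: v_def cochain_space_def)
    have v2: "v 2 \<in> cochain_space 2 0"
      by (simp add: v_def cochain_space_def min2 G_min2 del: One_nat_def)
    have "{p. v p \<noteq> (\<lambda>_. 0)} \<subseteq> {1, 2}" by (auto simp: v_def)
    then have "finite {p. v p \<noteq> (\<lambda>_. 0)}" by (rule finite_subset) simp
    moreover have "v p \<in> cochain_space p (2 - int p)" for p
      using v1 v2 zero_mem_cochain_space by (cases "p = 1 \<or> p = 2") (auto simp: v_def)
    ultimately have v: "v \<in> carrier (Tot_chains (twisted t) 2)"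
      by (simp add: Tot_carrier_iff)
    have "Tot_bd (twisted t) 2 v p = u p" for p
    proof -
      consider "p = 0" | "p = 1" | "p \<ge> 2" by linarith
      then show ?thesis
      proof cases
        case 1
        have "Tot_bd (twisted t) 2 v 0 = (\<lambda>_. (1 - t) * (w 1 - w 0))"
          using face_sum_twisted_1_0[OF v1, of t]
          by (simp add: Tot_bd_def coboundary_def) (simp add: v_def)
        also have "(1 - t) * (w 1 - w 0) = u 0 0"
          using assms by (simp add: w_def)
        also have "(\<lambda>_. u 0 0) = u 0" by (rule ext) (rule u0[symmetric])
        finally show ?thesis using 1 by simp
      next
        case 2
        have "Tot_bd (twisted t) 2 v 1 (prod_encode (i, j)) = u 1 (prod_encode (i, j))" for i j
        proof -
          \<comment> \<open>The face omitting the new vertex returns \<open>G\<close>; the other two contribute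
            zero or a diagonal value of \<open>G\<close>, and cancel each other.\<close>
          have "Tot_bd (twisted t) 2 v 1 (prod_encode (i, j)) =
            - (w j - w i) + (G (min i 1) (min j 1)
              - (if i = 0 \<or> j = 0 then 0 else G 1 1) + (if i = 0 \<or> j = 0 then 0 else G 0 0))"
            using face_sum_twisted_0_1[OF v2, of t]
            by (simp add: Tot_bd_def coboundary_def numeral_2_eq_2[symmetric])
              (auto simp: v_def min_def numeral_2_eq_2)
          then show ?thesis
            unfolding G_min using G_diag by (simp add: G_def)
        qed
        then show ?thesis unfolding 2 by (rule pair_fun_eqI)
      next
        case 3
        then show ?thesis
          using Tot_bd_closed[OF v, of p] u_mem[of p] by (simp add: cochain_space_def)
      qed
    qed
    then show ?thesis
      using v by (auto simp: boundaries_def Tot_def intro!: image_eqI[of _ _ v])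
  qed
  then show ?thesis unfolding Tot_homology_trivial_iff by blast
qed

theorem theorem1p1:
  shows "\<exists>(C :: (nat \<Rightarrow> complex) simplicial_obj) (D :: (nat \<Rightarrow> complex) simplicial_obj).
    simplicial_chain_complex C \<and> simplicial_chain_complex D \<and>
    (\<exists>\<phi> h.
      (\<forall>n. quasi_iso (level C n) (level D n) (\<phi> n)) \<and>
      (\<forall>m n. \<forall>\<alpha>\<in>simplex_hom m n.
        chain_homotopy (level C n) (level D m)
          (\<lambda>q. \<phi> m q \<circ> act C m n \<alpha> q) (\<lambda>q. act D m n \<alpha> q \<circ> \<phi> n q) (h m n \<alpha>))) \<and>
    \<not> (\<forall>k. \<exists>f. vs_iso (homology (Tot C) k) (homology (Tot D) k) f)"
proof (intro exI conjI)
  let ?\<phi> = "\<lambda>n q x. x :: nat \<Rightarrow> complex"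
  let ?h = "\<lambda>m n \<alpha> q f. if q = (0::int) then (\<lambda>_. (1 - 0) * f (prod_encode (0, \<alpha> (0::nat))))
    else (\<lambda>_::nat. 0::complex)"
  show "simplicial_chain_complex (twisted 0)" "simplicial_chain_complex (twisted 1)"
    by (rule simplicial_chain_complex_twisted)+
  show "\<forall>n. quasi_iso (level (twisted 0) n) (level (twisted 1) n) (?\<phi> n)"
    using chain_complex.quasi_iso_identity[OF chain_complex_cochain_cx] by simp
  show "\<forall>m n. \<forall>\<alpha>\<in>simplex_hom m n. chain_homotopy (level (twisted 0) n) (level (twisted 1) m)
      (\<lambda>q. ?\<phi> m q \<circ> act (twisted 0) m n \<alpha> q) (\<lambda>q. act (twisted 1) m n \<alpha> q \<circ> ?\<phi> n q) (?h m n \<alpha>)"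
    using chain_homotopy_twist[where s = 0 and t = 1] by (simp add: o_def)
  show "\<not> (\<forall>k. \<exists>f. vs_iso (homology (Tot (twisted 0)) k) (homology (Tot (twisted 1)) k) f)"
    using vs_iso_is_singleton Tot_homology_1_twisted_trivial[of 0]
      Tot_homology_1_twisted_nontrivial by (metis zero_neq_one)
qed

end
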